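(* Let $L(\lambda)=\lambda M+K\in\mathbb{C}^{n\times n}[\lambda]$ with $M$ Hermitian positive definite and $K^*=-K$. Let $x_1^c,\dots,x_p^c,x_{p+1}^f,\dots,x_n^f$ be a basis of $\mathbb{C}^n$ of eigenvectors of $L(\lambda)$ with $L(\lambda_i^c)x_i^c=0$ $(1\le i\le p)$ and $L(\lambda_j^f)x_j^f=0$ $(p+1\le j\le n)$, where $(x_i^c)^*Mx_j^c=0$ for $i\ne j$ and $(x_i^c)^*Mx_i^c=1$. Set $X_c=[x_1^c\ \cdots\ x_p^c]$, $X_f=[x_{p+1}^f\ \cdots\ x_n^f]$, $\Lambda_c=\mathrm{diag}(\lambda_i^c)$, $\Lambda_f=\mathrm{diag}(\lambda_j^f)$. Suppose $\{\lambda_1^c,\dots,\lambda_p^c\}\cap\{\lambda_{p+1}^f,\dots,\lambda_n^f\}=\emptyset$ and let $\Lambda_a\in\mathbb{C}^{p\times p}$ be a diagonal matrix with purely imaginary diagonal entries. Let $Z_1$ be an arbitrary real diagonal $p\times p$ matrix and $Z_2$ an arbitrary diagonal $p\times p$ matrix with purely imaginary diagonal entries. Put $H_a=(I_p-\Lambda_a^2)^{-1}$ and $$\hat M=H_a\left[(\Lambda_a-\Lambda_c)\Lambda_a+Z_1+Z_2\Lambda_a\right],\qquad \hat K=H_a\left[(\Lambda_c-\Lambda_a)-Z_1\Lambda_a-Z_2\Lambda_a^2\right],$$ $$\Delta M=MX_c\hat MX_c^*M,\qquad \Delta K=MX_c\hat KX_c^*M.$$ Then $(\Delta M)^*=\Delta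 M$, $(\Delta K)^*=-\Delta K$, and $(X_c,\Lambda_a)$ and $(X_f,\Lambda_f)$ are complementary deflating pairs of $L_\Delta(\lambda)=\lambda(M+\Delta M)+(K+\Delta K)$. Moreover, if $Z_1$ and $Z_2$ are chosen such that $(\Lambda_a-\Lambda_c)\Lambda_a+Z_1+Z_2\Lambda_a$ is a diagonal matrix with non-negative diagonal entries, then $\Delta M$ is positive semi-definite, and hence $M+\Delta M$ is positive definite.
   Context: A deflating pair of a pencil $\lambda M+K\in\mathbb{C}^{n\times n}[\lambda]$ is a matrix pair $(X,\Lambda)\in\mathbb{C}^{n\times p}\times\mathbb{C}^{p\times p}$ with $\operatorname{rank}X=p\le n$ and $MX\Lambda+KX=0$. Two deflating pairs $(X_1,\Lambda_1)$, $(X_2,\Lambda_2)$ are complementary if $[X_1\ X_2]$ is a nonsingular square matrix. $A^*$ is the conjugate transpose of $A$. Zero is allowed as a purely imaginary number. *)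

theory Defs
  imports
    "Jordan_Normal_Form.Schur_Decomposition"
    "Jordan_Normal_Form.Gauss_Jordan_Elimination"
    "Jordan_Normal_Form.DL_Rank"
begin

definition sesq :: "complex mat \<Rightarrow> complex vec \<Rightarrow> complex vec \<Rightarrow> complex" where
  "sesq A x y = conjugate x \<bullet> (A *\<^sub>v y)"

definition hermitian :: "complex mat \<Rightarrow> bool" where
  "hermitian A \<longleftrightarrow> mat_adjoint A = A"

(* The order on complex numbers is the one of HOL-Library.Complex_Order:
   0 \<le> z (0 < z) means that z is real and non-negative (positive). *)

definition pos_def :: "nat \<Rightarrow> complex mat \<Rightarrow> bool" where
  "pos_def n A \<longleftrightarrow> A \<in> carrier_mat n n \<and> hermitian A \<and>
     (\<forall>x \<in> carrier_vec n. x \<noteq> 0\<^sub>v n \<longrightarrow> 0 < sesq A x x)"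

definition pos_semidef :: "nat \<Rightarrow> complex mat \<Rightarrow> bool" where
  "pos_semidef n A \<longleftrightarrow> A \<in> carrier_mat n n \<and> hermitian A \<and>
     (\<forall>x \<in> carrier_vec n. 0 \<le> sesq A x x)"

(* A pencil is represented by its pair of coefficients M, K. *)

definition pencil :: "complex mat \<Rightarrow> complex mat \<Rightarrow> complex \<Rightarrow> complex mat" where
  "pencil M K z = z \<cdot>\<^sub>m M + K"

definition pencil_eigenvector ::
  "nat \<Rightarrow> complex mat \<Rightarrow> complex mat \<Rightarrow> complex \<Rightarrow> complex vec \<Rightarrow> bool" where
  "pencil_eigenvector n M K z x \<longleftrightarrow>
     x \<in> carrier_vec n \<and> x \<noteq> 0\<^sub>v n \<and> pencil M K z *\<^sub>v x = 0\<^sub>v n"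

definition deflating_pair ::
  "nat \<Rightarrow> nat \<Rightarrow> complex mat \<Rightarrow> complex mat \<Rightarrow> complex mat \<Rightarrow> complex mat \<Rightarrow> bool" where
  "deflating_pair n p M K X \<Lambda> \<longleftrightarrow>
     X \<in> carrier_mat n p \<and> \<Lambda> \<in> carrier_mat p p \<and> vec_space.rank n X = p \<and> p \<le> n \<and>
     M * X * \<Lambda> + K * X = 0\<^sub>m n p"

(* mat_of_cols n (cols X1 @ cols X2) is the block row [X1 X2];
   invertible_mat includes that the matrix is square. *)
definition complementary_deflating_pairs ::
  "nat \<Rightarrow> complex mat \<Rightarrow> complex mat \<Rightarrow> nat \<Rightarrow> complex mat \<Rightarrow> complex mat
    \<Rightarrow> nat \<Rightarrow> complex mat \<Rightarrow> complex mat \<Rightarrow> bool" where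
  "complementary_deflating_pairs n M K p1 X1 \<Lambda>1 p2 X2 \<Lambda>2 \<longleftrightarrow>
     deflating_pair n p1 M K X1 \<Lambda>1 \<and> deflating_pair n p2 M K X2 \<Lambda>2 \<and>
     invertible_mat (mat_of_cols n (cols X1 @ cols X2))"

(* "distinct" makes the list, not only the set of its members, a basis of C^n. *)
definition basis_list :: "nat \<Rightarrow> complex vec list \<Rightarrow> bool" where
  "basis_list n xs \<longleftrightarrow>
     distinct xs \<and> vectorspace.basis class_ring (module_vec TYPE(complex) n) (set xs)"

(* Meaningful for invertible A only; mat_inverse yields None otherwise. *)
definition mat_inv :: "complex mat \<Rightarrow> complex mat" where
  "mat_inv A = the (mat_inverse A)"

end

theory Submission
  imports Defs
begin

text \<open>
  Since \<open>M\<close> is positive definite and \<open>K\<close> is skew-Hermitian, the eigenvalues of the pencil are purely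
  imaginary and eigenvectors of different eigenvalues are orthogonal for the inner product of \<open>M\<close>:
  both are instances of \<open>skew_pencil_eigenvectors\<close>. With \<open>A = M * Xc\<close> the hypotheses therefore say
  \<open>A\<^sup>* * Xc = 1\<close> and \<open>A\<^sup>* * Xf = 0\<close>, and the updates are the congruences
  \<open>\<Delta>M = A * Mhat * A\<^sup>*\<close> and \<open>\<Delta>K = A * Khat * A\<^sup>*\<close>. So an update does not act on \<open>Xf\<close>, whose
  deflating equation survives unchanged, and it sends \<open>Xc\<close> to \<open>A * Mhat\<close> and \<open>A * Khat\<close>.

  Everything else takes place in diagonal matrices. Write \<open>a, c, z1, z2\<close> for diagonal entries of
  \<open>\<Lambda>a, \<Lambda>c, Z1, Z2\<close> and \<open>h = 1 / (1 - a\<^sup>2)\<close>, where \<open>1 - a\<^sup>2 = 1 + (Im a)\<^sup>2 > 0\<close>. As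
  \<open>K * Xc = - A * \<Lambda>c\<close>, the deflating equation for \<open>Xc\<close> and \<open>\<Lambda>a\<close> amounts to
  \<open>(1 + m) * a - c + k = 0\<close> for the entries \<open>m, k\<close> of \<open>Mhat, Khat\<close>. In \<open>m * a + k\<close> the terms with
  \<open>z1\<close> and \<open>z2\<close> cancel, which is why they are free parameters, and \<open>h * (a - c) * (a\<^sup>2 - 1) = c - a\<close>
  remains. Products of two imaginary numbers are real, so \<open>Mhat\<close> is real and \<open>Khat\<close> imaginary, and
  congruence passes this on to \<open>\<Delta>M\<close> and \<open>\<Delta>K\<close> as Hermitian and skew-Hermitian symmetry. Because
  \<open>h > 0\<close>, \<open>Mhat\<close> inherits non-negative entries from the bracket that \<open>Ha\<close> multiplies, and congruence keeps
  semi-definiteness as well (\<open>pos_semidef_congruence_diag\<close>). Rank and complementarity depend only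
  on the given basis.
\<close>

section \<open>Adjoints and sesquilinear forms\<close>

lemma mat_adjoint_dim [simp]:
  "dim_row (mat_adjoint A) = dim_col A" "dim_col (mat_adjoint A) = dim_row A"
  unfolding mat_adjoint_def by auto

lemma mat_adjoint_carrier [simp]:
  "A \<in> carrier_mat m n \<Longrightarrow> mat_adjoint A \<in> carrier_mat n m"
  by (intro carrier_matI) auto

lemma mat_adjoint_index [simp]:
  "i < dim_col A \<Longrightarrow> j < dim_row A \<Longrightarrow> mat_adjoint A $$ (i, j) = conjugate (A $$ (j, i))"
  unfolding mat_adjoint_def by (simp add: mat_of_rows_index)

lemma mat_adjoint_adjoint [simp]: "mat_adjoint (mat_adjoint A) = A"
  by (rule eq_matI) auto

lemma mat_adjoint_mult:
  fixes A B :: "complex mat"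
  assumes "A \<in> carrier_mat m k" "B \<in> carrier_mat k n"
  shows "mat_adjoint (A * B) = mat_adjoint B * mat_adjoint A"
  by (rule eq_matI, insert assms)
    (auto simp: scalar_prod_def mult.commute intro!: sum.cong)

lemma mat_adjoint_diag:
  fixes d :: "nat \<Rightarrow> complex"
  shows "mat_adjoint (mat_diag p d) = mat_diag p (\<lambda>i. cnj (d i))"
  by (rule eq_matI) (auto simp: mat_diag_def)

lemma sesq_eq_sum:
  assumes "A \<in> carrier_mat n m" "x \<in> carrier_vec n" "y \<in> carrier_vec m"
  shows "sesq A x y = (\<Sum>i<n. \<Sum>j<m. cnj (x $ i) * A $$ (i, j) * y $ j)"
  using assms unfolding sesq_def scalar_prod_def
  by (auto simp: scalar_prod_def sum_distrib_left mult.assoc lessThan_atLeast0 intro!: sum.cong)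

lemma sesq_adjoint:
  assumes "A \<in> carrier_mat n m" "x \<in> carrier_vec n" "y \<in> carrier_vec m"
  shows "sesq (mat_adjoint A) y x = cnj (sesq A x y)"
proof -
  have "sesq (mat_adjoint A) y x = (\<Sum>j<m. \<Sum>i<n. cnj (y $ j) * cnj (A $$ (i, j)) * x $ i)"
    using assms by (subst sesq_eq_sum[of _ m n]) auto
  also have "\<dots> = (\<Sum>i<n. \<Sum>j<m. cnj (y $ j) * cnj (A $$ (i, j)) * x $ i)"
    by (rule sum.swap)
  also have "\<dots> = cnj (sesq A x y)"
    using assms by (subst sesq_eq_sum[of _ n m]) (auto simp: mult_ac)
  finally show ?thesis .
qed

lemma sesq_add:
  assumes "A \<in> carrier_mat n m" "B \<in> carrier_mat n m" "x \<in> carrier_vec n" "y \<in> carrier_vec m"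
  shows "sesq (A + B) x y = sesq A x y + sesq B x y"
  using assms
  by (simp add: sesq_eq_sum[of _ n m] distrib_left distrib_right sum.distrib)

lemma sesq_smult:
  assumes "A \<in> carrier_mat n m" "x \<in> carrier_vec n" "y \<in> carrier_vec m"
  shows "sesq (c \<cdot>\<^sub>m A) x y = c * sesq A x y"
  using assms
  by (simp add: sesq_eq_sum[of _ n m] sum_distrib_left mult_ac)

lemma sesq_uminus:
  assumes "A \<in> carrier_mat n m" "x \<in> carrier_vec n" "y \<in> carrier_vec m"
  shows "sesq (- A) x y = - sesq A x y"
  using assms
  by (simp add: sesq_eq_sum[of _ n m] sum_negf)

lemma sesq_mult_right:
  assumes "A \<in> carrier_mat n m" "B \<in> carrier_mat m k" "x \<in> carrier_vec n" "y \<in> carrier_vec k"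
  shows "sesq (A * B) x y = sesq A x (B *\<^sub>v y)"
  using assms unfolding sesq_def by (simp add: assoc_mult_mat_vec[of _ n m _ k])

lemma sesq_mult_left:
  assumes A: "A \<in> carrier_mat n m" and B: "B \<in> carrier_mat m k"
    and x: "x \<in> carrier_vec n" and y: "y \<in> carrier_vec k"
  shows "sesq (A * B) x y = sesq B (mat_adjoint A *\<^sub>v x) y"
proof -
  have "sesq (A * B) x y = cnj (sesq (mat_adjoint B * mat_adjoint A) y x)"
    using sesq_adjoint[of "A * B" n k x y] assms by (simp add: mat_adjoint_mult[OF A B])
  also have "\<dots> = cnj (sesq (mat_adjoint B) y (mat_adjoint A *\<^sub>v x))"
    using assms by (subst sesq_mult_right[of _ k m _ n]) auto
  also have "\<dots> = sesq B (mat_adjoint A *\<^sub>v x) y"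
    using assms by (subst sesq_adjoint[of _ m k]) (auto intro!: mult_mat_vec_carrier[of _ m n])
  finally show ?thesis .
qed

lemma index_adjoint_mult_mult:
  assumes "X \<in> carrier_mat n p" "A \<in> carrier_mat n n" "Y \<in> carrier_mat n q" "i < p" "j < q"
  shows "(mat_adjoint X * (A * Y)) $$ (i, j) = sesq A (col X i) (col Y j)"
proof -
  have "row (mat_adjoint X) i = conjugate (col X i)"
    using assms by (intro eq_vecI) auto
  moreover have "col (A * Y) j = A *\<^sub>v col Y j"
    using assms by (intro eq_vecI) auto
  ultimately show ?thesis using assms by (simp add: sesq_def)
qed

section \<open>Diagonal matrices and congruences\<close>

lemma diagonal_mat_eq_mat_diag:
  assumes "A \<in> carrier_mat p p" "diagonal_mat A"
  shows "A = mat_diag p (\<lambda>i. A $$ (i, i))"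
  using assms by (intro eq_matI) (auto simp: mat_diag_def diagonal_mat_def)

lemma dim_mat_diag [simp]: "dim_row (mat_diag p d) = p" "dim_col (mat_diag p d) = p"
  unfolding mat_diag_def by auto

lemma mat_diag_add: "mat_diag p f + mat_diag p g = mat_diag p (\<lambda>i. f i + g i :: complex)"
  by (rule eq_matI) (auto simp: mat_diag_def)

lemma mat_diag_minus: "mat_diag p f - mat_diag p g = mat_diag p (\<lambda>i. f i - g i :: complex)"
  by (rule eq_matI) (auto simp: mat_diag_def)

lemma mat_diag_uminus: "- mat_diag p f = mat_diag p (\<lambda>i. - f i :: complex)"
  by (rule eq_matI) (auto simp: mat_diag_def)

lemma index_mult_mat_diag:
  fixes d :: "nat \<Rightarrow> complex"
  assumes "A \<in> carrier_mat n p" "i < n" "j < p"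
  shows "(A * mat_diag p d) $$ (i, j) = A $$ (i, j) * d j"
  unfolding mat_diag_mult_right[OF assms(1)] using assms by simp

lemma mat_diag_cong: "(\<And>i. i < p \<Longrightarrow> f i = g i) \<Longrightarrow> mat_diag p f = mat_diag p g"
  by (rule eq_matI) (auto simp: mat_diag_def)

text \<open>
  The inverse is only known through some two-sided inverse that Gauss-Jordan elimination returns, so
  the entries are read off from the uniqueness of inverses.
\<close>

lemma mat_inv_mat_diag:
  assumes nz: "\<And>i. i < p \<Longrightarrow> d i \<noteq> 0"
  shows "mat_inv (mat_diag p d) = mat_diag p (\<lambda>i. inverse (d i))"
proof -
  let ?D = "mat_diag p d" and ?E = "mat_diag p (\<lambda>i. inverse (d i))"
  have DE: "?D * ?E = 1\<^sub>m p" and ED: "?E * ?D = 1\<^sub>m p"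
    using nz by (auto simp flip: mat_diag_one intro!: mat_diag_cong)
  then have "?D \<in> Units (ring_mat TYPE(complex) p ())"
    unfolding Units_def ring_mat_def by (auto intro!: bexI[of _ ?E])
  then obtain B where B: "mat_inverse ?D = Some B"
    using mat_inverse(1)[of ?D p "()"] by fastforce
  then have "B * ?D = 1\<^sub>m p" "B \<in> carrier_mat p p"
    using mat_inverse(2)[OF mat_diag_dim B] by auto
  then have "B = ?E"
    using DE assoc_mult_mat[of B p p ?D p ?E p]
    by (metis left_mult_one_mat mat_diag_dim right_mult_one_mat)
  then show ?thesis unfolding mat_inv_def B by simp
qed

lemma mat_adjoint_congruence:
  fixes A D :: "complex mat"
  assumes A: "A \<in> carrier_mat n p" and D: "D \<in> carrier_mat p p"
  shows "mat_adjoint (A * D * mat_adjoint A) = A * mat_adjoint D * mat_adjoint A"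
proof -
  have "mat_adjoint (A * D * mat_adjoint A) = A * (mat_adjoint D * mat_adjoint A)"
    using assms mat_adjoint_mult[of "A * D" n p "mat_adjoint A" n] mat_adjoint_mult[OF A D]
    by simp
  then show ?thesis using assms by (simp add: assoc_mult_mat[of _ n p _ p _ n])
qed

lemma sesq_mat_diag:
  assumes "x \<in> carrier_vec p"
  shows "sesq (mat_diag p d) x x = (\<Sum>i<p. d i * of_real ((cmod (x $ i))\<^sup>2))"
proof -
  have "(\<Sum>j<p. cnj (x $ i) * mat_diag p d $$ (i, j) * x $ j) = d i * of_real ((cmod (x $ i))\<^sup>2)"
    if "i < p" for i
  proof -
    have "(\<Sum>j<p. cnj (x $ i) * mat_diag p d $$ (i, j) * x $ j)
        = (\<Sum>j<p. if j = i then cnj (x $ i) * d i * x $ i else 0)"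
      using that by (intro sum.cong) (auto simp: mat_diag_def)
    also have "\<dots> = d i * of_real ((cmod (x $ i))\<^sup>2)"
      using that by (simp add: complex_norm_square mult_ac del: of_real_power)
    finally show ?thesis .
  qed
  then show ?thesis using assms by (simp add: sesq_eq_sum[of _ p p])
qed

text \<open>
  The form of \<open>A * D * A\<^sup>*\<close> at \<open>x\<close> is the form of \<open>D\<close> at \<open>y = A\<^sup>* x\<close>, a sum of terms
  \<open>d i * \<bar>y i\<bar>\<^sup>2\<close>.
\<close>

lemma pos_semidef_congruence_diag:
  assumes A: "A \<in> carrier_mat n p" and d: "\<And>i. i < p \<Longrightarrow> 0 \<le> d i"
  shows "pos_semidef n (A * mat_diag p d * mat_adjoint A)"
proof -
  have "cnj (d i) = d i" if "i < p" for i
    using d[OF that] by (simp add: complex_eq_iff less_eq_complex_def)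
  then have "mat_adjoint (mat_diag p d) = mat_diag p d"
    unfolding mat_adjoint_diag by (intro mat_diag_cong)
  then have "hermitian (A * mat_diag p d * mat_adjoint A)"
    unfolding hermitian_def using mat_adjoint_congruence[OF A mat_diag_dim] by simp
  moreover have "0 \<le> sesq (A * mat_diag p d * mat_adjoint A) x x" if x: "x \<in> carrier_vec n" for x
  proof -
    let ?y = "mat_adjoint A *\<^sub>v x"
    have y: "?y \<in> carrier_vec p" using A x by (auto intro!: mult_mat_vec_carrier[of _ p n])
    have "sesq (A * mat_diag p d * mat_adjoint A) x x = sesq (A * mat_diag p d) x ?y"
      using A x by (intro sesq_mult_right[of _ n p _ n]) auto
    also have "\<dots> = sesq (mat_diag p d) ?y ?y"
      using A x y by (intro sesq_mult_left[of _ n p _ p]) auto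
    also have "\<dots> = (\<Sum>i<p. d i * of_real ((cmod (?y $ i))\<^sup>2))"
      by (rule sesq_mat_diag[OF y])
    also have "0 \<le> \<dots>"
      by (rule sum_nonneg) (use d in \<open>auto simp: less_eq_complex_def\<close>)
    finally show ?thesis .
  qed
  ultimately show ?thesis using A unfolding pos_semidef_def by auto
qed

lemma pos_def_add_pos_semidef:
  assumes A: "pos_def n A" and B: "pos_semidef n B"
  shows "pos_def n (A + B)"
proof -
  have c: "A \<in> carrier_mat n n" "B \<in> carrier_mat n n"
    using A B by (auto simp: pos_def_def pos_semidef_def)
  have "mat_adjoint (A + B) = mat_adjoint A + mat_adjoint B"
    using c by (intro eq_matI) auto
  then have "hermitian (A + B)"
    using A B by (auto simp: pos_def_def pos_semidef_def hermitian_def)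
  moreover have "0 < sesq (A + B) x x" if "x \<in> carrier_vec n" "x \<noteq> 0\<^sub>v n" for x
  proof -
    have "0 < sesq A x x" "0 \<le> sesq B x x"
      using A B that by (auto simp: pos_def_def pos_semidef_def)
    then show ?thesis
      using sesq_add[OF c that(1) that(1)] by (auto simp: less_complex_def less_eq_complex_def)
  qed
  ultimately show ?thesis using c by (auto simp: pos_def_def)
qed

section \<open>Eigenvectors of the pencil\<close>

lemma pencil_eigenvector_sesq:
  assumes "M \<in> carrier_mat n n" "K \<in> carrier_mat n n" "x \<in> carrier_vec n"
    and "pencil_eigenvector n M K z y"
  shows "z * sesq M x y + sesq K x y = 0"
proof -
  have y: "y \<in> carrier_vec n" "(z \<cdot>\<^sub>m M + K) *\<^sub>v y = 0\<^sub>v n"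
    using assms unfolding pencil_eigenvector_def pencil_def by auto
  have "z * sesq M x y + sesq K x y = sesq (z \<cdot>\<^sub>m M + K) x y"
    using assms y by (simp add: sesq_add[of _ n n] sesq_smult[of _ n n])
  also have "\<dots> = 0" using assms y by (simp add: sesq_def)
  finally show ?thesis .
qed

text \<open>
  Pairing \<open>(w M + K) y = 0\<close> with \<open>x\<close> gives \<open>w * (x\<^sup>* M y) + x\<^sup>* K y = 0\<close>; pairing \<open>(z M + K) x = 0\<close>
  with \<open>y\<close> and conjugating gives \<open>cnj z * (x\<^sup>* M y) - x\<^sup>* K y = 0\<close>. Their sum is free of \<open>K\<close>. The case
  \<open>x = y\<close> locates the eigenvalues, the case \<open>z \<noteq> w\<close> yields orthogonality.
\<close>

lemma skew_pencil_eigenvectors: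
  assumes M: "M \<in> carrier_mat n n" "mat_adjoint M = M"
    and K: "K \<in> carrier_mat n n" "mat_adjoint K = - K"
    and x: "pencil_eigenvector n M K z x" and y: "pencil_eigenvector n M K w y"
  shows "(cnj z + w) * sesq M x y = 0"
proof -
  have c: "x \<in> carrier_vec n" "y \<in> carrier_vec n"
    using x y by (auto simp: pencil_eigenvector_def)
  have 1: "w * sesq M x y + sesq K x y = 0"
    by (rule pencil_eigenvector_sesq[OF M(1) K(1) c(1) y])
  have "z * sesq M y x + sesq K y x = 0"
    by (rule pencil_eigenvector_sesq[OF M(1) K(1) c(2) x])
  then have "cnj z * cnj (sesq M y x) + cnj (sesq K y x) = 0"
    by (metis complex_cnj_add complex_cnj_mult complex_cnj_zero)
  moreover have "cnj (sesq M y x) = sesq M x y" "cnj (sesq K y x) = - sesq K x y"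
    using sesq_adjoint[of M n n y x] sesq_adjoint[of K n n y x] sesq_uminus[of K n n x y] M K c
    by simp_all
  ultimately have "cnj z * sesq M x y - sesq K x y = 0"
    by simp
  with 1 have "w * sesq M x y + sesq K x y + (cnj z * sesq M x y - sesq K x y) = 0"
    by simp
  then show ?thesis by (simp add: algebra_simps)
qed

lemma pencil_eigenvalue_imaginary:
  assumes M: "pos_def n M" and K: "K \<in> carrier_mat n n" "mat_adjoint K = - K"
    and x: "pencil_eigenvector n M K z x"
  shows "Re z = 0"
proof -
  have M': "M \<in> carrier_mat n n" "mat_adjoint M = M"
    using M by (auto simp: pos_def_def hermitian_def)
  have "0 < sesq M x x" using M x by (auto simp: pos_def_def pencil_eigenvector_def)
  then have "sesq M x x \<noteq> 0" by auto
  then have "cnj z + z = 0" using skew_pencil_eigenvectors[OF M' K x x] by simp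
  then show ?thesis by (simp add: complex_eq_iff)
qed

lemma pencil_eigenvectors_orthogonal:
  assumes M: "pos_def n M" and K: "K \<in> carrier_mat n n" "mat_adjoint K = - K"
    and x: "pencil_eigenvector n M K z x" and y: "pencil_eigenvector n M K w y"
    and "z \<noteq> w"
  shows "sesq M x y = 0"
proof -
  have M': "M \<in> carrier_mat n n" "mat_adjoint M = M"
    using M by (auto simp: pos_def_def hermitian_def)
  have "cnj z = - z"
    using pencil_eigenvalue_imaginary[OF M K x] by (simp add: complex_eq_iff)
  then show ?thesis using skew_pencil_eigenvectors[OF M' K x y] \<open>z \<noteq> w\<close> by auto
qed

lemma pencil_eigenvectors_mat:
  assumes M: "M \<in> carrier_mat n n" and K: "K \<in> carrier_mat n n" and xs: "length xs = q"
    and eig: "\<And>i. i < q \<Longrightarrow> pencil_eigenvector n M K (l i) (xs ! i)"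
  shows "M * mat_of_cols n xs * mat_diag q l + K * mat_of_cols n xs = 0\<^sub>m n q"
proof -
  let ?X = "mat_of_cols n xs"
  have X: "?X \<in> carrier_mat n q" using xs by auto
  have MX: "M * ?X \<in> carrier_mat n q" using M X by auto
  have "(M * ?X * mat_diag q l + K * ?X) $$ (i, j) = 0" if i: "i < n" and j: "j < q" for i j
  proof -
    have e: "xs ! j \<in> carrier_vec n" "(l j \<cdot>\<^sub>m M + K) *\<^sub>v (xs ! j) = 0\<^sub>v n"
      using eig[OF j] by (auto simp: pencil_eigenvector_def pencil_def)
    have col: "col ?X j = xs ! j" using e j xs by auto
    have "(M * ?X * mat_diag q l + K * ?X) $$ (i, j)
        = l j * (row M i \<bullet> (xs ! j)) + row K i \<bullet> (xs ! j)"
      unfolding mat_diag_mult_right[OF MX] using M K xs i j col by simp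
    also have "\<dots> = (l j \<cdot>\<^sub>v row M i + row K i) \<bullet> (xs ! j)"
      using M K i e(1) by (simp add: add_scalar_prod_distrib[of _ n])
    also have "l j \<cdot>\<^sub>v row M i + row K i = row (l j \<cdot>\<^sub>m M + K) i"
      using M K i by (intro eq_vecI) auto
    also have "\<dots> \<bullet> (xs ! j) = ((l j \<cdot>\<^sub>m M + K) *\<^sub>v (xs ! j)) $ i"
      using M K i by simp
    finally show ?thesis using e(2) i by simp
  qed
  then show ?thesis using M K xs by (intro eq_matI) auto
qed

section \<open>Bases as column lists\<close>

lemma rank_mat_of_cols_basis_part:
  assumes basis: "basis_list n bs" and sub: "distinct xs" "set xs \<subseteq> set bs"
  shows "vec_space.rank n (mat_of_cols n xs) = length xs"
proof -
  interpret vec_space "TYPE(complex)" n .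
  have b: "lin_indpt (set bs)" "set bs \<subseteq> carrier_vec n"
    using basis unfolding basis_list_def basis_def by auto
  have "cols (mat_of_cols n xs) = xs" using sub b by (intro cols_mat_of_cols) auto
  moreover have "lin_indpt (set xs)" by (rule subset_li_is_li[OF b(1) sub(2)])
  ultimately show ?thesis using sub by (intro lin_indpt_full_rank) auto
qed

lemma invertible_mat_of_cols_basis:
  assumes basis: "basis_list n bs" and len: "length bs = n"
  shows "invertible_mat (mat_of_cols n bs)"
proof -
  interpret vec_space "TYPE(complex)" n .
  let ?X = "mat_of_cols n bs"
  have X: "?X \<in> carrier_mat n n" using len by auto
  have "rank ?X = n"
    using rank_mat_of_cols_basis_part[OF basis, of bs] basis len by (auto simp: basis_list_def)
  then have "det ?X \<noteq> 0" using det_rank_iff[OF X] by simp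
  from det_non_zero_imp_unit[OF X this, of "()"] show ?thesis
    using X unfolding Units_def ring_mat_def invertible_mat_def inverts_mat_def by auto
qed

section \<open>Eigenvalue embedding without spill-over\<close>

theorem mainTheorem7:
  fixes n p :: nat
    and M K :: "complex mat"
    and xc xf :: "complex vec list"
    and lc lf :: "complex list"
    and Xc Xf \<Lambda>c \<Lambda>f \<Lambda>a Z1 Z2 Ha Mhat Khat \<Delta>M \<Delta>K :: "complex mat"
  assumes M: "pos_def n M"
    and K: "K \<in> carrier_mat n n" "mat_adjoint K = - K"
    and p: "p \<le> n"
    and lengths: "length xc = p" "length lc = p" "length xf = n - p" "length lf = n - p"
    and basis: "basis_list n (xc @ xf)"
    and eig_c: "\<And>i. i < p \<Longrightarrow> pencil_eigenvector n M K (lc ! i) (xc ! i)"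
    and eig_f: "\<And>j. j < n - p \<Longrightarrow> pencil_eigenvector n M K (lf ! j) (xf ! j)"
    and orth: "\<And>i j. i < p \<Longrightarrow> j < p \<Longrightarrow> i \<noteq> j \<Longrightarrow> sesq M (xc ! i) (xc ! j) = 0"
    and norm: "\<And>i. i < p \<Longrightarrow> sesq M (xc ! i) (xc ! i) = 1"
    and Xc: "Xc = mat_of_cols n xc"
    and Xf: "Xf = mat_of_cols n xf"
    and \<Lambda>c: "\<Lambda>c = mat_diag p (\<lambda>i. lc ! i)"
    and \<Lambda>f: "\<Lambda>f = mat_diag (n - p) (\<lambda>j. lf ! j)"
    and disj: "set lc \<inter> set lf = {}"
    and \<Lambda>a: "\<Lambda>a \<in> carrier_mat p p" "diagonal_mat \<Lambda>a" "\<And>i. i < p \<Longrightarrow> Re (\<Lambda>a $$ (i, i)) = 0"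
    and Z1: "Z1 \<in> carrier_mat p p" "diagonal_mat Z1" "\<And>i. i < p \<Longrightarrow> Z1 $$ (i, i) \<in> \<real>"
    and Z2: "Z2 \<in> carrier_mat p p" "diagonal_mat Z2" "\<And>i. i < p \<Longrightarrow> Re (Z2 $$ (i, i)) = 0"
    and Ha: "Ha = mat_inv (1\<^sub>m p - \<Lambda>a * \<Lambda>a)"
    and Mhat: "Mhat = Ha * ((\<Lambda>a - \<Lambda>c) * \<Lambda>a + Z1 + Z2 * \<Lambda>a)"
    and Khat: "Khat = Ha * ((\<Lambda>c - \<Lambda>a) - Z1 * \<Lambda>a - Z2 * (\<Lambda>a * \<Lambda>a))"
    and \<Delta>M: "\<Delta>M = M * Xc * Mhat * mat_adjoint Xc * M"
    and \<Delta>K: "\<Delta>K = M * Xc * Khat * mat_adjoint Xc * M"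
  shows "mat_adjoint \<Delta>M = \<Delta>M \<and> mat_adjoint \<Delta>K = - \<Delta>K \<and>
    complementary_deflating_pairs n (M + \<Delta>M) (K + \<Delta>K) p Xc \<Lambda>a (n - p) Xf \<Lambda>f \<and>
    (diagonal_mat ((\<Lambda>a - \<Lambda>c) * \<Lambda>a + Z1 + Z2 * \<Lambda>a) \<and>
     (\<forall>i < p. 0 \<le> ((\<Lambda>a - \<Lambda>c) * \<Lambda>a + Z1 + Z2 * \<Lambda>a) $$ (i, i)) \<longrightarrow>
     pos_semidef n \<Delta>M \<and> pos_def n (M + \<Delta>M))"
proof -
  have Mc: "M \<in> carrier_mat n n" and Mh: "mat_adjoint M = M"
    using M by (auto simp: pos_def_def hermitian_def)
  have Xc_c: "Xc \<in> carrier_mat n p" and Xf_c: "Xf \<in> carrier_mat n (n - p)"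
    using lengths unfolding Xc Xf by auto
  have xc_c: "xc ! i \<in> carrier_vec n" if "i < p" for i
    using eig_c[OF that] by (simp add: pencil_eigenvector_def)
  have xf_c: "xf ! j \<in> carrier_vec n" if "j < n - p" for j
    using eig_f[OF that] by (simp add: pencil_eigenvector_def)
  have cols_c: "cols Xc = xc" and cols_f: "cols Xf = xf"
    unfolding Xc Xf using xc_c xf_c lengths by (auto simp: in_set_conv_nth intro!: cols_mat_of_cols)
  have col_c: "col Xc i = xc ! i" if "i < p" for i
    unfolding Xc using xc_c that lengths by auto
  have col_f: "col Xf j = xf ! j" if "j < n - p" for j
    unfolding Xf using xf_c that lengths by auto

  define a where "a i = \<Lambda>a $$ (i, i)" for i
  define z1 where "z1 i = Z1 $$ (i, i)" for i
  define z2 where "z2 i = Z2 $$ (i, i)" for i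
  define c where "c i = lc ! i" for i
  define g where "g i = (a i - c i) * a i + z1 i + z2 i * a i" for i
  define h where "h i = inverse (1 - a i * a i)" for i
  define m where "m i = h i * g i" for i
  define k where "k i = h i * ((c i - a i) - z1 i * a i - z2 i * (a i * a i))" for i
  have diag: "\<Lambda>a = mat_diag p a" "Z1 = mat_diag p z1" "Z2 = mat_diag p z2" "\<Lambda>c = mat_diag p c"
    using diagonal_mat_eq_mat_diag[OF \<Lambda>a(1,2)] diagonal_mat_eq_mat_diag[OF Z1(1,2)]
      diagonal_mat_eq_mat_diag[OF Z2(1,2)] \<Lambda>c
    by (simp_all add: a_def [abs_def] z1_def [abs_def] z2_def [abs_def] c_def [abs_def])
  have re: "Re (a i) = 0" "Im (z1 i) = 0" "Re (z2 i) = 0" "Re (c i) = 0" if "i < p" for i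
    using \<Lambda>a(3) Z1(3) Z2(3) pencil_eigenvalue_imaginary[OF M K eig_c] that
    by (auto simp: a_def z1_def z2_def c_def complex_is_Real_iff)
  have den: "1 - a i * a i = of_real (1 + (Im (a i))\<^sup>2)" if "i < p" for i
    using re[OF that] by (simp add: complex_eq_iff power2_eq_square)
  have pos: "0 < 1 + (Im (a i))\<^sup>2" for i
    by (simp add: add_pos_nonneg)
  have nz: "1 - a i * a i \<noteq> 0" if "i < p" for i
    unfolding den[OF that] using pos[of i] by (metis less_irrefl of_real_eq_0_iff)
  have h: "h i = of_real (inverse (1 + (Im (a i))\<^sup>2))" if "i < p" for i
    unfolding h_def den[OF that] by simp
  have "1\<^sub>m p - \<Lambda>a * \<Lambda>a = mat_diag p (\<lambda>i. 1 - a i * a i)"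
    unfolding diag mat_diag_diag mat_diag_one[symmetric] mat_diag_minus ..
  then have Ha': "Ha = mat_diag p h"
    unfolding Ha h_def [abs_def] using mat_inv_mat_diag[OF nz] by simp
  have G: "(\<Lambda>a - \<Lambda>c) * \<Lambda>a + Z1 + Z2 * \<Lambda>a = mat_diag p g"
    unfolding diag g_def [abs_def] by (simp add: mat_diag_add mat_diag_minus)
  have Mhat': "Mhat = mat_diag p m"
    unfolding Mhat G Ha' m_def [abs_def] by simp
  have Khat': "Khat = mat_diag p k"
    unfolding Khat Ha' diag k_def [abs_def] by (simp add: mat_diag_minus)
  have m_real: "cnj (m i) = m i" and k_imag: "cnj (k i) = - k i" if "i < p" for i
  proof -
    have cnj: "cnj (a i) = - a i" "cnj (c i) = - c i" "cnj (z1 i) = z1 i" "cnj (z2 i) = - z2 i"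
      using re[OF that] by (simp_all add: complex_eq_iff)
    have "cnj (h i) = h i" unfolding h[OF that] by simp
    then show "cnj (m i) = m i" "cnj (k i) = - k i"
      unfolding m_def k_def g_def by (simp_all add: cnj algebra_simps)
  qed
  \<comment> \<open>This is the \<open>i\<close>-th column of the deflating equation with the vector \<open>M *\<^sub>v (xc ! i)\<close> divided out.\<close>
  have balance: "(1 + m i) * a i - c i + k i = 0" if "i < p" for i
  proof -
    have "m i * a i + k i = h i * (1 - a i * a i) * (c i - a i)"
      unfolding m_def k_def g_def by (simp add: algebra_simps)
    also have "\<dots> = c i - a i" unfolding h_def using nz[OF that] by simp
    finally show ?thesis by (simp add: algebra_simps)
  qed

  define A where "A = M * Xc"
  have A: "A \<in> carrier_mat n p" using Mc Xc_c by (auto simp: A_def)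
  have A_adj: "mat_adjoint A = mat_adjoint Xc * M"
    unfolding A_def using mat_adjoint_mult[OF Mc Xc_c] Mh by simp
  \<comment> \<open>The trailing factors \<open>Xc\<^sup>* * M\<close> are the adjoint of \<open>A\<close> because \<open>M\<close> is Hermitian.\<close>
  have congr: "M * Xc * D * mat_adjoint Xc * M = A * D * mat_adjoint A"
    if "D \<in> carrier_mat p p" for D
    unfolding A_adj using that A Mc Xc_c
    by (simp add: A_def[symmetric] assoc_mult_mat[of "A * D" n p "mat_adjoint Xc" n M n])
  have \<Delta>M': "\<Delta>M = A * mat_diag p m * mat_adjoint A"
    and \<Delta>K': "\<Delta>K = A * mat_diag p k * mat_adjoint A"
    unfolding \<Delta>M \<Delta>K Mhat' Khat' by (simp_all add: congr)
  have \<Delta>c: "\<Delta>M \<in> carrier_mat n n" "\<Delta>K \<in> carrier_mat n n"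
    unfolding \<Delta>M' \<Delta>K' using A by auto
  have "mat_adjoint (mat_diag p m) = mat_diag p m"
    unfolding mat_adjoint_diag using m_real by (rule mat_diag_cong)
  then have adj_M: "mat_adjoint \<Delta>M = \<Delta>M"
    unfolding \<Delta>M' by (simp add: mat_adjoint_congruence[OF A])
  have "mat_adjoint (mat_diag p k) = - mat_diag p k"
    unfolding mat_adjoint_diag mat_diag_uminus using k_imag by (rule mat_diag_cong)
  then have adj_K: "mat_adjoint \<Delta>K = - \<Delta>K"
    unfolding \<Delta>K' using A by (simp add: mat_adjoint_congruence[OF A])

  have Ac: "mat_adjoint A * Xc = 1\<^sub>m p"
  proof -
    have "mat_adjoint A * Xc = mat_adjoint Xc * (M * Xc)"
      unfolding A_adj using Mc Xc_c by (simp add: assoc_mult_mat[of _ p n _ n _ p])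
    also have "\<dots> = 1\<^sub>m p"
      using Mc Xc_c orth norm
      by (intro eq_matI) (auto simp: index_adjoint_mult_mult[of _ n p _ _ p] col_c simp del: index_mult_mat(1))
    finally show ?thesis .
  qed
  have Af: "mat_adjoint A * Xf = 0\<^sub>m p (n - p)"
  proof -
    have "mat_adjoint A * Xf = mat_adjoint Xc * (M * Xf)"
      unfolding A_adj using Mc Xc_c Xf_c by (simp add: assoc_mult_mat[of _ p n _ n _ "n - p"])
    moreover have "sesq M (xc ! i) (xf ! j) = 0" if "i < p" "j < n - p" for i j
    proof -
      have "lc ! i \<noteq> lf ! j" using disj lengths that by (metis disjoint_iff nth_mem)
      then show ?thesis
        by (rule pencil_eigenvectors_orthogonal[OF M K eig_c[OF that(1)] eig_f[OF that(2)]])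
    qed
    ultimately show ?thesis
      using Mc Xc_c Xf_c
      by (intro eq_matI)
        (auto simp: index_adjoint_mult_mult[of _ n p _ _ "n - p"] col_c col_f simp del: index_mult_mat(1))
  qed
  have update_c: "(B + A * D * mat_adjoint A) * Xc = B * Xc + A * D"
    if "B \<in> carrier_mat n n" "D \<in> carrier_mat p p" for B D
  proof -
    have "A * D * mat_adjoint A * Xc = A * D * (mat_adjoint A * Xc)"
      using that A Xc_c by (intro assoc_mult_mat[of _ n p _ n _ p]) auto
    moreover have "(B + A * D * mat_adjoint A) * Xc = B * Xc + A * D * mat_adjoint A * Xc"
      using that A Xc_c by (intro add_mult_distrib_mat[of _ n n _ _ p]) auto
    ultimately show ?thesis
      using that A Xc_c Ac by simp
  qed
  have update_f: "(B + A * D * mat_adjoint A) * Xf = B * Xf"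
    if "B \<in> carrier_mat n n" "D \<in> carrier_mat p p" for B D
  proof -
    have "A * D * mat_adjoint A * Xf = A * D * (mat_adjoint A * Xf)"
      using that A Xf_c by (intro assoc_mult_mat[of _ n p _ n _ "n - p"]) auto
    moreover have "(B + A * D * mat_adjoint A) * Xf = B * Xf + A * D * mat_adjoint A * Xf"
      using that A Xf_c by (intro add_mult_distrib_mat[of _ n n _ _ "n - p"]) auto
    ultimately show ?thesis
      using that A Xf_c Af by simp
  qed
  have deflate_c: "(M + \<Delta>M) * Xc * \<Lambda>a + (K + \<Delta>K) * Xc = 0\<^sub>m n p"
  proof -
    have eq: "A * mat_diag p c + K * Xc = 0\<^sub>m n p"
      unfolding A_def Xc using pencil_eigenvectors_mat[OF Mc K(1) lengths(1), of c] eig_c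
      by (simp add: c_def)
    have lhs: "(M + \<Delta>M) * Xc * \<Lambda>a + (K + \<Delta>K) * Xc
        = (A + A * mat_diag p m) * mat_diag p a + (K * Xc + A * mat_diag p k)"
      unfolding \<Delta>M' \<Delta>K' update_c[OF Mc mat_diag_dim] update_c[OF K(1) mat_diag_dim] diag
      by (simp only: A_def)
    have "(A + A * mat_diag p m) * mat_diag p a + (K * Xc + A * mat_diag p k)
        = A * mat_diag p c + K * Xc"
    proof (rule eq_matI)
      fix i j assume "i < dim_row (A * mat_diag p c + K * Xc)" "j < dim_col (A * mat_diag p c + K * Xc)"
      then have ij: "i < n" "j < p" using K Xc_c by auto
      have "A $$ (i, j) * ((1 + m j) * a j - c j + k j) = 0" using balance[OF ij(2)] by simp
      then have *: "(A $$ (i, j) + A $$ (i, j) * m j) * a j + A $$ (i, j) * k j = A $$ (i, j) * c j"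
        by (simp add: algebra_simps)
      have c1: "A + A * mat_diag p m \<in> carrier_mat n p" using A by auto
      show "((A + A * mat_diag p m) * mat_diag p a + (K * Xc + A * mat_diag p k)) $$ (i, j)
          = (A * mat_diag p c + K * Xc) $$ (i, j)"
        using ij K Xc_c A c1 *
        by (simp add: index_mult_mat_diag[OF c1] index_mult_mat_diag[OF A] algebra_simps
            del: index_mult_mat(1))
    qed (use A K Xc_c in auto)
    then show ?thesis unfolding lhs eq by simp
  qed
  have deflate_f: "(M + \<Delta>M) * Xf * \<Lambda>f + (K + \<Delta>K) * Xf = 0\<^sub>m n (n - p)"
    unfolding \<Delta>M' \<Delta>K' update_f[OF Mc mat_diag_dim] update_f[OF K(1) mat_diag_dim]
    unfolding \<Lambda>f Xf
    by (rule pencil_eigenvectors_mat[OF Mc K(1) lengths(3) eig_f])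
  have dist: "distinct xc" "distinct xf" using basis by (auto simp: basis_list_def)
  have "vec_space.rank n Xc = p" "vec_space.rank n Xf = n - p"
    unfolding Xc Xf using rank_mat_of_cols_basis_part[OF basis] dist lengths by auto
  moreover have "invertible_mat (mat_of_cols n (cols Xc @ cols Xf))"
    unfolding cols_c cols_f using p lengths by (intro invertible_mat_of_cols_basis[OF basis]) auto
  ultimately have compl:
    "complementary_deflating_pairs n (M + \<Delta>M) (K + \<Delta>K) p Xc \<Lambda>a (n - p) Xf \<Lambda>f"
    unfolding complementary_deflating_pairs_def deflating_pair_def
    using deflate_c deflate_f Xc_c Xf_c \<Lambda>a(1) \<Lambda>f p by auto
  have "pos_semidef n \<Delta>M \<and> pos_def n (M + \<Delta>M)"
    if nonneg: "\<forall>i < p. 0 \<le> ((\<Lambda>a - \<Lambda>c) * \<Lambda>a + Z1 + Z2 * \<Lambda>a) $$ (i, i)"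
  proof -
    have "0 \<le> m i" if "i < p" for i
    proof -
      have "0 \<le> g i" using nonneg that unfolding G by (simp add: mat_diag_def)
      moreover have "0 \<le> h i" unfolding h[OF that] using pos[of i] by (simp add: less_eq_complex_def)
      ultimately show ?thesis by (simp add: m_def less_eq_complex_def)
    qed
    then have "pos_semidef n \<Delta>M"
      unfolding \<Delta>M' by (rule pos_semidef_congruence_diag[OF A])
    then show ?thesis using pos_def_add_pos_semidef[OF M] by simp
  qed
  then show ?thesis using adj_M adj_K compl by blast
qed

end
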